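(* Let $\ell\ge 2$ be an integer and let $\alpha_s=\alpha_s^{(\ell,2)}(1,q)$ be defined by $\alpha_0=1$, $$\alpha_{3r}=q^{\frac32(\ell-3)r^2-\frac12(9-\ell)r}+q^{\frac32(\ell-3)r^2+\frac12(9-\ell)r}\quad(r\ge 1),$$ $$\alpha_{3r+1}=-q^{\frac32(\ell-3)r^2+\frac12(\ell+3)r+1}\quad(r\ge 0),\qquad \alpha_{3r-1}=-q^{\frac32(\ell-3)r^2-\frac12(\ell+3)r+1}\quad(r\ge 1).$$ Let $\beta_n=\beta_n^{(\ell,2)}(1,q)=\sum_{s=0}^n\frac{\alpha_s}{(q;q)_{n-s}(q;q)_{n+s}}$ for $n\ge 0$, and $\beta_{-1}=0$. Then $$\sum_{m=0}^\infty q^{9m^2}\left(q^{-6m+1}\beta_{3m-1}+\beta_{3m}+q^{6m+1}\beta_{3m+1}\right)=\frac{(q^2,q^{\ell+1},q^{\ell+3};q^{\ell+3})_\infty\,(q^{\ell-1},q^{\ell+7};q^{2\ell+6})_\infty}{(q;q)_\infty}.$$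
   Context: $q$ is a formal variable (rational functions of $q$ are expanded as Laurent series in $q$ at $0$); equivalently one may take $0<|q|<1$. Notation: $(a;q)_k=\prod_{j=0}^{k-1}(1-aq^j)$ for $k\ge 0$, $(a;q)_\infty=\prod_{j\ge 0}(1-aq^j)$, and $(a_1,\dots,a_t;q)_\infty=(a_1;q)_\infty\cdots(a_t;q)_\infty$. *)

theory Defs
  imports "HOL-Analysis.Analysis"
begin

definition qpoch :: "complex \<Rightarrow> complex \<Rightarrow> nat \<Rightarrow> complex" where
  "qpoch a q k = (\<Prod>j<k. 1 - a * q ^ j)"

definition qpoch_inf :: "complex \<Rightarrow> complex \<Rightarrow> complex" where
  "qpoch_inf a q = (\<Prod>j. 1 - a * q ^ j)"

definition qpochs_inf :: "complex list \<Rightarrow> complex \<Rightarrow> complex" where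
  "qpochs_inf as q = (\<Prod>a\<leftarrow>as. qpoch_inf a q)"

text \<open>
  The half-integer coefficients in the exponents of the \<open>\<alpha>\<^sub>s\<close> are cleared by writing
  \<open>\<dots> div 2\<close> on integers; the division is exact (see \<open>bailey_alpha_exponents_even\<close> below).
  The exponents can be negative, hence \<open>powi\<close>. The clauses indexed by \<open>3r\<close>, \<open>3r+1\<close> and
  \<open>3r-1\<close> are spelled out in \<open>bailey_alpha_eqs\<close>.
\<close>

definition bailey_alpha :: "nat \<Rightarrow> complex \<Rightarrow> nat \<Rightarrow> complex" where
  "bailey_alpha l q s =
    (if s = 0 then 1
     else if s mod 3 = 0 then
       (let r = int (s div 3) in
          q powi ((3 * (int l - 3) * r\<^sup>2 - (9 - int l) * r) div 2)
        + q powi ((3 * (int l - 3) * r\<^sup>2 + (9 - int l) * r) div 2))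
     else if s mod 3 = 1 then
       (let r = int (s div 3) in
          - (q powi ((3 * (int l - 3) * r\<^sup>2 + (int l + 3) * r) div 2 + 1)))
     else
       (let r = int ((s + 1) div 3) in
          - (q powi ((3 * (int l - 3) * r\<^sup>2 - (int l + 3) * r) div 2 + 1))))"

text \<open>The index is an integer so that \<open>\<beta>\<^sub>-\<^sub>1 = 0\<close> can be stated literally.\<close>

definition bailey_beta :: "nat \<Rightarrow> complex \<Rightarrow> int \<Rightarrow> complex" where
  "bailey_beta l q n =
    (if n < 0 then 0
     else \<Sum>s=0..nat n. bailey_alpha l q s / (qpoch q q (nat n - s) * qpoch q q (nat n + s)))"

lemma bailey_alpha_exponents_even:
  fixes l r :: int
  shows "even (3 * (l - 3) * r\<^sup>2 - (9 - l) * r)"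
    and "even (3 * (l - 3) * r\<^sup>2 + (9 - l) * r)"
    and "even (3 * (l - 3) * r\<^sup>2 + (l + 3) * r)"
    and "even (3 * (l - 3) * r\<^sup>2 - (l + 3) * r)"
  by auto

lemma bailey_alpha_eqs:
  shows "bailey_alpha l q 0 = 1"
    and "r \<ge> 1 \<Longrightarrow> bailey_alpha l q (3 * r) =
           q powi ((3 * (int l - 3) * (int r)\<^sup>2 - (9 - int l) * int r) div 2)
         + q powi ((3 * (int l - 3) * (int r)\<^sup>2 + (9 - int l) * int r) div 2)"
    and "bailey_alpha l q (3 * r + 1) =
         - (q powi ((3 * (int l - 3) * (int r)\<^sup>2 + (int l + 3) * int r) div 2 + 1))"
    and "r \<ge> 1 \<Longrightarrow> bailey_alpha l q (3 * r - 1) =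
         - (q powi ((3 * (int l - 3) * (int r)\<^sup>2 - (int l + 3) * int r) div 2 + 1))"
proof -
  show "bailey_alpha l q 0 = 1"
    by (simp only: bailey_alpha_def if_True refl simp_thms)
next
  assume r: "r \<ge> 1"
  have "(3 * r) mod 3 = 0" "(3 * r) div 3 = r" "3 * r \<noteq> 0"
    using r by simp_all
  then show "bailey_alpha l q (3 * r) =
           q powi ((3 * (int l - 3) * (int r)\<^sup>2 - (9 - int l) * int r) div 2)
         + q powi ((3 * (int l - 3) * (int r)\<^sup>2 + (9 - int l) * int r) div 2)"
    by (simp only: bailey_alpha_def Let_def if_True if_False simp_thms)
next
  have "(3 * r + 1) mod 3 = 1" "(3 * r + 1) div 3 = r" "3 * r + 1 \<noteq> 0" "(1::nat) \<noteq> 0"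
    by simp_all
  then show "bailey_alpha l q (3 * r + 1) =
         - (q powi ((3 * (int l - 3) * (int r)\<^sup>2 + (int l + 3) * int r) div 2 + 1))"
    by (simp only: bailey_alpha_def Let_def if_True if_False simp_thms)
next
  assume r: "r \<ge> 1"
  then obtain k where k: "r = Suc k" by (cases r) simp_all
  have "3 * r - 1 = 3 * k + 2" "3 * r - 1 + 1 = 3 * r" using k by simp_all
  moreover have "(3 * k + 2) mod 3 = 2" by presburger
  ultimately have "(3 * r - 1) mod 3 = 2" "(3 * r - 1 + 1) div 3 = r" "3 * r - 1 \<noteq> 0"
       "(2::nat) \<noteq> 0" "(2::nat) \<noteq> 1"
    by (simp_all only:)
  then show "bailey_alpha l q (3 * r - 1) =
         - (q powi ((3 * (int l - 3) * (int r)\<^sup>2 - (int l + 3) * int r) div 2 + 1))"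
    by (simp only: bailey_alpha_def Let_def if_True if_False simp_thms)
qed

end

theory Submission
  imports Defs
begin

text \<open>
  Since \<open>9m\<^sup>2 \<plusminus> 6m + 1 = (3m \<plusminus> 1)\<^sup>2\<close>, the left-hand side is \<open>\<Sum> q\<^bsup>n\<^sup>2\<^esup> \<beta>\<^sub>n\<close> with the terms taken in threes. By
  the limiting case of Bailey's lemma, which rests on the Durfee rectangle identity
  \<open>\<Sum>\<^sub>k q\<^bsup>k\<^sup>2 + ck\<^esup> / ((q;q)\<^sub>k (q;q)\<^sub>k\<^sub>+\<^sub>c) = 1 / (q;q)\<^sub>\<infinity>\<close>, it equals
  \<open>\<Sum> q\<^bsup>s\<^sup>2\<^esup> \<alpha>\<^sub>s / (q;q)\<^sub>\<infinity>\<close>. The terms \<open>s = 3r - 1, 3r, 3r + 1\<close> of this series are the terms of index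
  \<open>\<plusminus>r\<close> of the quintuple product series with base \<open>q\<^bsup>\<ell>+3\<^esup>\<close> and argument \<open>q\<^sup>2\<close>. The quintuple product
  identity itself is the limit of a finite identity with a telescoping (WZ) proof.
\<close>

section \<open>Finite and infinite q-shifted factorials\<close>

lemma qpoch_0 [simp]: "qpoch a q 0 = 1"
  by (simp add: qpoch_def)

lemma qpoch_Suc: "qpoch a q (Suc n) = qpoch a q n * (1 - a * q ^ n)"
  by (simp add: qpoch_def)

lemma qpoch_add: "qpoch a q (m + n) = qpoch a q m * qpoch (a * q ^ m) q n"
  by (induction n) (simp_all add: qpoch_Suc power_add mult_ac)

lemma qpoch_Suc_left: "qpoch a q (Suc n) = (1 - a) * qpoch (a * q) q n"
  using qpoch_add[of a q 1 n] by (simp add: qpoch_Suc)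

lemma qpoch_eq_0_iff: "qpoch a q n = 0 \<longleftrightarrow> (\<exists>j<n. a * q ^ j = 1)"
  by (auto simp: qpoch_def)

lemma qpoch_mult_uminus: "qpoch (a\<^sup>2) (q\<^sup>2) n = qpoch a q n * qpoch (- a) q n"
  by (induction n) (simp_all add: qpoch_Suc algebra_simps power2_eq_square power_mult_distrib)

lemma qpoch_even_odd: "qpoch a q (2 * n) = qpoch a (q\<^sup>2) n * qpoch (a * q) (q\<^sup>2) n"
  by (induction n) (simp_all add: qpoch_Suc mult_ac flip: power_mult)

lemma power_neq_1_of_norm_less_1:
  fixes q :: complex
  assumes "norm q < 1" "n > 0"
  shows "q ^ n \<noteq> 1"
proof
  assume "q ^ n = 1"
  then have "norm q ^ n = 1" by (metis norm_one norm_power)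
  with assms show False using power_eq_1_iff[of "norm q" n] by auto
qed

lemma qpoch_self_nonzero: "norm q < 1 \<Longrightarrow> qpoch q q n \<noteq> 0"
  using power_neq_1_of_norm_less_1[of q "Suc _"] by (auto simp: qpoch_eq_0_iff)

lemma convergent_prod_qpoch:
  fixes q :: complex
  assumes "norm q < 1"
  shows "convergent_prod (\<lambda>j. 1 - a * q ^ j)"
proof -
  have "summable (\<lambda>j. norm (1 - a * q ^ j - 1))"
    using assms by (simp add: norm_mult norm_power summable_mult)
  then show ?thesis
    using abs_convergent_prod_conv_summable abs_convergent_prod_imp_convergent_prod by blast
qed

lemma qpoch_tendsto:
  assumes "norm q < 1"
  shows "(\<lambda>n. qpoch a q n) \<longlonglongrightarrow> qpoch_inf a q"
  using convergent_prod_LIMSEQ[OF convergent_prod_qpoch[OF assms, of a]]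
  by (subst filterlim_sequentially_Suc[symmetric])
     (simp add: qpoch_def qpoch_inf_def lessThan_Suc_atMost)

lemma qpoch_inf_nonzero:
  assumes "norm q < 1" "\<And>j. a * q ^ j \<noteq> 1"
  shows "qpoch_inf a q \<noteq> 0"
  unfolding qpoch_inf_def
  using assms by (intro prodinf_nonzero convergent_prod_qpoch) auto

lemma qpoch_self_inf_nonzero: "norm q < 1 \<Longrightarrow> qpoch_inf q q \<noteq> 0"
  using power_neq_1_of_norm_less_1[of q "Suc _"] by (intro qpoch_inf_nonzero) auto

text \<open>With \<open>qpoch_inf_even_odd\<close>, this brings products in \<open>z\<^sup>2\<close>
  and base \<open>q\<close> to the mixed bases \<open>q\<close> and \<open>q\<^sup>2\<close> of the
  quintuple product.\<close>

lemma qpoch_inf_mult_uminus: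
  assumes "norm q < 1"
  shows "qpoch_inf (a\<^sup>2) (q\<^sup>2) = qpoch_inf a q * qpoch_inf (- a) q"
proof (rule LIMSEQ_unique)
  have "norm (q\<^sup>2) < 1" using assms by (simp add: norm_power power_less_one_iff abs_square_less_1)
  then show "(\<lambda>n. qpoch (a\<^sup>2) (q\<^sup>2) n) \<longlonglongrightarrow> qpoch_inf (a\<^sup>2) (q\<^sup>2)"
    by (rule qpoch_tendsto)
  show "(\<lambda>n. qpoch (a\<^sup>2) (q\<^sup>2) n) \<longlonglongrightarrow> qpoch_inf a q * qpoch_inf (- a) q"
    unfolding qpoch_mult_uminus by (intro tendsto_mult qpoch_tendsto assms)
qed

lemma qpoch_inf_even_odd:
  assumes "norm q < 1"
  shows "qpoch_inf a q = qpoch_inf a (q\<^sup>2) * qpoch_inf (a * q) (q\<^sup>2)"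
proof (rule LIMSEQ_unique)
  have q2: "norm (q\<^sup>2) < 1" using assms by (simp add: norm_power power_less_one_iff abs_square_less_1)
  show "(\<lambda>n. qpoch a q (2 * n)) \<longlonglongrightarrow> qpoch_inf a q"
    using LIMSEQ_subseq_LIMSEQ[OF qpoch_tendsto[OF assms, of a], of "\<lambda>n. 2 * n"]
    by (simp add: strict_mono_def o_def)
  show "(\<lambda>n. qpoch a q (2 * n)) \<longlonglongrightarrow> qpoch_inf a (q\<^sup>2) * qpoch_inf (a * q) (q\<^sup>2)"
    unfolding qpoch_even_odd by (intro tendsto_mult qpoch_tendsto q2)
qed

text \<open>The reciprocals converge because the infinite product is nonzero, so they are bounded;
  the constant feeds the dominating series used below.\<close>

lemma qpoch_inverse_bounded:
  assumes "norm q < 1" "\<And>j. a * q ^ j \<noteq> 1"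
  obtains C where "C > 0" "\<And>n. norm (inverse (qpoch a q n)) \<le> C"
proof -
  have "(\<lambda>n. inverse (qpoch a q n)) \<longlonglongrightarrow> inverse (qpoch_inf a q)"
    by (intro tendsto_inverse qpoch_tendsto qpoch_inf_nonzero assms)
  then have "Bseq (\<lambda>n. inverse (qpoch a q n))"
    using convergent_imp_Bseq convergentI by blast
  then show ?thesis using that unfolding Bseq_def by blast
qed

section \<open>A finite form of the quintuple product identity\<close>

text \<open>
  The WZ equation \<open>F(N+1,k) - F(N,k) = G(N+1,k+1) - G(N+1,k)\<close>, for the summand \<open>F\<close> below and the \<open>G\<close>
  in the proof of the finite identity, divided by common factors; here \<open>x = q\<^sup>k\<close> and
  \<open>y = q\<^sup>N\<^sup>-\<^sup>k\<close>.
\<close>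
lemma quintuple_certificate:
  fixes q x y z :: complex
  assumes "1 - y * q \<noteq> 0" "1 - z\<^sup>2 * x \<noteq> 0" "1 - z\<^sup>2 * x * (x * y * q) \<noteq> 0"
  shows "(1 - z * x) * (1 + z * (x * y * q)) * (1 - x * y * q)
           / ((1 - y * q) * ((1 - z\<^sup>2 * x) * (1 - z\<^sup>2 * x * (x * y * q))))
         - (1 - z * x) / (1 - z\<^sup>2 * x)
       = y * (z * x\<^sup>2 * q) / (1 - z\<^sup>2 * x * (x * y * q)) + y * q * (1 - x) / ((1 - y * q) * (1 - z\<^sup>2 * x))"
  using assms by (simp add: divide_simps) algebra

text \<open>The quotient with base point \<open>q\<close> is the Gaussian binomial coefficient. The
  normalisation makes the sum over \<open>k\<close> equal to 1 for every \<open>n\<close>, as the WZ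
  method requires.\<close>

definition quintuple_summand :: "complex \<Rightarrow> complex \<Rightarrow> nat \<Rightarrow> nat \<Rightarrow> complex" where
  "quintuple_summand z q n k =
     (1 - z * q ^ k) * (qpoch q q n / (qpoch q q k * qpoch q q (n - k)))
     * (qpoch (- z) q (Suc n) / qpoch (z\<^sup>2 * q ^ k) q (Suc n)) * (- z) ^ k * q ^ k\<^sup>2"

text \<open>Induction on \<open>n\<close>: for \<open>k\<close> up to \<open>N\<close> the
  increments of the summand telescope in \<open>k\<close>, and the new term \<open>k = Suc N\<close>
  cancels the boundary term that is left.\<close>

lemma finite_quintuple_product:
  fixes q z :: complex
  assumes q: "norm q < 1" and z: "\<And>j. z\<^sup>2 * q ^ j \<noteq> 1"
  shows "(\<Sum>k\<le>n. quintuple_summand z q n k) = 1"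
proof (induction n)
  case 0
  have "(1 - z) * (1 + z) = 1 - z\<^sup>2" by (simp add: algebra_simps power2_eq_square)
  with z[of 0] show ?case by (simp add: quintuple_summand_def qpoch_Suc)
next
  case (Suc N)
  \<comment> \<open>The WZ companion of the summand. Its factor \<open>1 - q ^ k\<close> vanishes at
    \<open>k = 0\<close>, so only the upper end of the telescoping sum survives.\<close>
  define G where "G k = - (q ^ (Suc N - k)) 
      * ((1 - q ^ k) * (qpoch q q N / (qpoch q q k * qpoch q q (Suc N - k))))
      * (qpoch (- z) q (Suc N) / qpoch (z\<^sup>2 * q ^ k) q (Suc N)) * (- z) ^ k * q ^ k\<^sup>2" for k
  have G0: "G 0 = 0" by (simp add: G_def)
  have nz: "qpoch q q m \<noteq> 0" for m
    by (rule qpoch_self_nonzero[OF q])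
  have nz2: "qpoch (z\<^sup>2 * q ^ k) q m \<noteq> 0" for k m
    using z[of "k + _"] by (auto simp: qpoch_eq_0_iff power_add mult_ac)
  have step: "quintuple_summand z q (Suc N) k - quintuple_summand z q N k = G (Suc k) - G k"
    if "k \<le> N" for k
  proof -
    define x y where "x = q ^ k" and "y = q ^ (N - k)"
    \<comment> \<open>\<open>D\<close> is shared by the denominators of all four terms of the WZ
      equation. Dividing out \<open>A\<close> leaves the rational identity
      \<open>quintuple_certificate\<close> in \<open>q\<close>, \<open>x\<close>, \<open>y\<close>
      and \<open>z\<close>.\<close>
    define D where "D = qpoch (z\<^sup>2 * q ^ Suc k) q N"
    define A where "A = qpoch q q N / (qpoch q q k * qpoch q q (N - k))
        * (qpoch (- z) q (Suc N) / D) * (- z) ^ k * q ^ k\<^sup>2"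
    have qN: "q ^ N = x * y"
      using that by (simp add: x_def y_def flip: power_add)
    have D0: "D \<noteq> 0" unfolding D_def by (rule nz2)
    have nk: "qpoch q q (Suc N - k) = qpoch q q (N - k) * (1 - y * q)"
      using that by (simp add: Suc_diff_le qpoch_Suc y_def)
    have n1: "1 - y * q \<noteq> 0"
      using power_neq_1_of_norm_less_1[OF q, of "Suc (N - k)"] by (simp add: y_def mult.commute)
    have n2: "1 - z\<^sup>2 * x \<noteq> 0" using z[of k] by (simp add: x_def)
    have n3: "1 - z\<^sup>2 * x * (x * y * q) \<noteq> 0"
      using z[of "k + Suc N"] by (simp add: x_def[symmetric] qN power_add mult_ac)
    have n4: "1 - x * q \<noteq> 0"
      using power_neq_1_of_norm_less_1[OF q, of "Suc k"] by (simp add: x_def mult.commute)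
    have d1: "qpoch (z\<^sup>2 * q ^ k) q (Suc N) = (1 - z\<^sup>2 * x) * D"
      by (simp add: qpoch_Suc_left D_def x_def mult_ac)
    have d2: "qpoch (z\<^sup>2 * q ^ k) q (Suc (Suc N)) = (1 - z\<^sup>2 * x) * (1 - z\<^sup>2 * x * (x * y * q)) * D"
      unfolding qpoch_Suc[of _ _ "Suc N"] d1 by (simp add: x_def[symmetric] qN mult_ac)
    have d3: "qpoch (z\<^sup>2 * q ^ Suc k) q (Suc N) = (1 - z\<^sup>2 * x * (x * y * q)) * D"
      unfolding qpoch_Suc by (simp add: x_def[symmetric] qN D_def mult_ac)
    have F1: "quintuple_summand z q (Suc N) k =
        A * ((1 - z * x) * (1 + z * (x * y * q)) * (1 - x * y * q)
           / ((1 - y * q) * ((1 - z\<^sup>2 * x) * (1 - z\<^sup>2 * x * (x * y * q)))))"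
      unfolding quintuple_summand_def d2 nk A_def qpoch_Suc[of q q N] qpoch_Suc[of "-z" q "Suc N"]
      by (simp add: x_def[symmetric] qN mult_ac)
    have F2: "quintuple_summand z q N k = A * ((1 - z * x) / (1 - z\<^sup>2 * x))"
      unfolding quintuple_summand_def d1 A_def by (simp add: x_def mult_ac)
    have G1: "G (Suc k) = A * (y * (z * x\<^sup>2 * q) / (1 - z\<^sup>2 * x * (x * y * q)))"
    proof -
      have 1: "(1 - q ^ Suc k) * (qpoch q q N / (qpoch q q (Suc k) * c)) = qpoch q q N / (qpoch q q k * c)" for c
        using n4 by (simp add: qpoch_Suc x_def mult_ac)
      have 2: "q ^ (Suc k)\<^sup>2 = q ^ k\<^sup>2 * x\<^sup>2 * q"
        by (simp add: x_def power2_eq_square flip: power_add power_mult) (simp add: power_add mult_ac)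
      show ?thesis
        unfolding G_def diff_Suc_Suc 1 2 d3 A_def by (simp add: y_def mult_ac)
    qed
    have G2: "G k = - (A * (y * q * (1 - x) / ((1 - y * q) * (1 - z\<^sup>2 * x))))"
      unfolding G_def nk d1 A_def using that
      by (simp add: x_def y_def Suc_diff_le mult_ac)
    have "A * a - A * b = A * c - - (A * d)" if "a - b = c + d" for a b c d
      using that by (metis diff_minus_eq_add distrib_left right_diff_distrib)
    then show ?thesis
      unfolding F1 F2 G1 G2 using quintuple_certificate[OF n1 n2 n3] by blast
  qed
  have "(\<Sum>k\<le>N. quintuple_summand z q (Suc N) k) - (\<Sum>k\<le>N. quintuple_summand z q N k)
       = (\<Sum>k\<le>N. G (Suc k) - G k)"
    unfolding sum_subtractf[symmetric] by (intro sum.cong step) auto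
  also have "\<dots> = G (Suc N)"
    using sum_lessThan_telescope[of G "Suc N"] G0 by (simp add: lessThan_Suc_atMost)
  \<comment> \<open>Here the last factor of the denominator is a difference of squares, which
    cancels \<open>1 - z * q ^ Suc N\<close> and the last factor of
    \<open>qpoch (- z) q (Suc (Suc N))\<close>.\<close>
  moreover have "quintuple_summand z q (Suc N) (Suc N) = - G (Suc N)"
  proof -
    have "z\<^sup>2 * q ^ Suc N * q ^ Suc N = (z * q ^ Suc N)\<^sup>2"
      by (simp add: power2_eq_square mult_ac)
    then have e: "1 - z\<^sup>2 * q ^ Suc N * q ^ Suc N = (1 - z * q ^ Suc N) * (1 + z * q ^ Suc N)"
      by (simp only:) (simp add: algebra_simps power2_eq_square)
    have n: "1 - z * q ^ Suc N \<noteq> 0" "1 + z * q ^ Suc N \<noteq> 0" "1 - q ^ Suc N \<noteq> 0"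
      using e z[of "Suc N + Suc N"] power_neq_1_of_norm_less_1[OF q, of "Suc N"]
      by (auto simp: power_add mult_ac)
    have h: "(1 - q ^ Suc N) * (qpoch q q N / (qpoch q q (Suc N) * 1)) = 1"
      using n nz[of N] by (simp add: qpoch_Suc)
    have "(1 - z * q ^ Suc N) * (qpoch (- z) q (Suc (Suc N)) / qpoch (z\<^sup>2 * q ^ Suc N) q (Suc (Suc N)))
        = qpoch (- z) q (Suc N) / qpoch (z\<^sup>2 * q ^ Suc N) q (Suc N)"
      unfolding qpoch_Suc[of _ _ "Suc N"] e using n by simp
    with h nz[of "Suc N"] show ?thesis
      unfolding quintuple_summand_def G_def by (simp del: power_Suc)
  qed
  ultimately show ?case using Suc by (simp add: algebra_simps)
qed

section \<open>Recentring the finite identity at its middle index\<close>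

lemma qpoch_reverse:
  fixes q b :: complex
  assumes "q \<noteq> 0" "b \<noteq> 0"
  shows "qpoch (b / q ^ n) q n = (- b) ^ n * qpoch (q / b) q n / q ^ (\<Sum>{..n})"
proof (induction n)
  case (Suc n)
  have "qpoch (b / q ^ Suc n) q (Suc n) = (1 - b / q ^ Suc n) * qpoch (b / q ^ n) q n"
    using assms by (simp add: qpoch_Suc_left)
  \<comment> \<open>Factors are reversed one at a time; the powers of \<open>q\<close> pulled out
    add up to the triangular exponent \<open>\<Sum>{..n}\<close>.\<close>
  also have "1 - b / q ^ Suc n = (- b) * (1 - q / b * q ^ n) / q ^ Suc n"
    using assms by (simp add: field_simps)
  finally show ?case
    unfolding Suc by (simp add: qpoch_Suc power_add mult_ac)
qed simp

text \<open>The general term of the bilateral quintuple product series. Since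
  \<open>k * (3 * k - 1)\<close> is even, \<open>div 2\<close> is exact.\<close>

definition quintuple_series_term :: "complex \<Rightarrow> complex \<Rightarrow> int \<Rightarrow> complex" where
  "quintuple_series_term z q k = (1 - z * q powi k) * z powi (3 * k) * q powi (k * (3 * k - 1) div 2)"

text \<open>Replacing \<open>z\<close> by \<open>z / q ^ N\<close> in the identity of length
  \<open>2 * N\<close> lets \<open>k = j - N\<close> run from \<open>- N\<close> to
  \<open>N\<close>. Reversing the factors with negative powers of \<open>q\<close> splits off the
  series term; what remains is a quotient that converges as \<open>N\<close> grows with
  \<open>k\<close> fixed.\<close>

lemma quintuple_summand_shifted:
  fixes q z :: complex
  assumes q: "q \<noteq> 0" and z: "z \<noteq> 0" and j: "j \<le> 2 * N"
  shows "quintuple_summand (z / q ^ N) q (2 * N) j =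
    quintuple_series_term z q (int j - int N)
    * (qpoch q q (2 * N) * qpoch (- q / z) q N * qpoch (- z) q (Suc N))
    / (qpoch q q j * qpoch q q (2 * N - j) * (qpoch (q / z\<^sup>2) q (2 * N - j) * qpoch (z\<^sup>2) q (Suc j)))"
proof -
  define a where "a = 2 * N - j"
  define k where "k = int j - int N"
  have ja: "a + j = 2 * N" using j by (simp add: a_def)
  have jk: "int j = int N + k" "int a = int N - k" using ja by (auto simp: k_def)
  have 1: "z / q ^ N * q ^ j = z * q powi k"
    using q by (simp add: k_def power_int_diff)
  \<comment> \<open>Only the first \<open>N\<close> factors carry negative powers of
    \<open>q\<close> and need reversing; the other \<open>Suc N\<close> form
    \<open>qpoch (- z) q (Suc N)\<close>.\<close>
  have 2: "qpoch (- (z / q ^ N)) q (Suc (2 * N))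
      = z ^ N * qpoch (- q / z) q N / q ^ (\<Sum>{..N}) * qpoch (- z) q (Suc N)"
    using qpoch_add[of "- z / q ^ N" q N "Suc N"] qpoch_reverse[OF q, of "- z" N] q z
    by (simp add: mult_2)
  have 3: "qpoch ((z / q ^ N)\<^sup>2 * q ^ j) q (Suc (2 * N))
      = (- (z\<^sup>2)) ^ a * qpoch (q / z\<^sup>2) q a / q ^ (\<Sum>{..a}) * qpoch (z\<^sup>2) q (Suc j)"
  proof -
    have "(z / q ^ N)\<^sup>2 * q ^ j = z\<^sup>2 / q ^ a"
      using q ja by (simp add: field_simps flip: power_add power_mult)
    then show ?thesis
      using qpoch_add[of "z\<^sup>2 / q ^ a" q a "Suc j"] qpoch_reverse[OF q, of "z\<^sup>2" a] q z ja
      by simp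
  qed
  \<comment> \<open>The signs cancel because \<open>a + j\<close> is even.\<close>
  have 4: "z ^ N / (- (z\<^sup>2)) ^ a * (- (z / q ^ N)) ^ j = z powi (3 * k) / q ^ (N * j)"
  proof -
    have "(- 1 :: complex) ^ j = (- 1) ^ a"
      using ja by (metis even_add even_mult_iff even_numeral minus_one_power_iff)
    then have "z ^ N / (- (z\<^sup>2)) ^ a * (- (z / q ^ N)) ^ j = z ^ N / z ^ (2 * a) * z ^ j / q ^ (N * j)"
      by (simp add: power_minus[of "z\<^sup>2"] power_minus[of "z / _"] power_divide flip: power_mult)
    also have "z ^ N / z ^ (2 * a) * z ^ j = z powi (int N - int (2 * a) + int j)"
      using z by (simp add: power_int_add power_int_diff flip: power_int_of_nat)
    also have "int N - int (2 * a) + int j = 3 * k"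
      using jk by simp
    finally show ?thesis .
  qed
  have 5: "q ^ (\<Sum>{..a}) / q ^ (\<Sum>{..N}) / q ^ (N * j) * q ^ j\<^sup>2 = q powi (k * (3 * k - 1) div 2)"
  proof -
    have g: "2 * int (\<Sum>{..n}) = int n * (int n + 1)" for n
      by (induction n) (simp_all add: algebra_simps)
    have "q ^ (\<Sum>{..a}) / q ^ (\<Sum>{..N}) / q ^ (N * j) * q ^ j\<^sup>2
        = q powi (int (\<Sum>{..a}) - int (\<Sum>{..N}) - int (N * j) + int (j\<^sup>2))"
      using q by (simp add: power_int_add power_int_diff del: of_nat_sum of_nat_mult of_nat_power)
    also have "int (\<Sum>{..a}) - int (\<Sum>{..N}) - int (N * j) + int (j\<^sup>2) = k * (3 * k - 1) div 2"
    proof -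
      have "2 * (int (\<Sum>{..a}) - int (\<Sum>{..N}) - int (N * j) + int (j\<^sup>2))
          = int a * (int a + 1) - int N * (int N + 1) - 2 * (int N * int j) + 2 * (int j)\<^sup>2"
        using g[of a] g[of N] by (simp del: of_nat_sum add: right_diff_distrib)
      also have "\<dots> = k * (3 * k - 1)"
        unfolding jk by (simp add: algebra_simps power2_eq_square)
      finally have "2 * (int (\<Sum>{..a}) - int (\<Sum>{..N}) - int (N * j) + int (j\<^sup>2)) = k * (3 * k - 1)" .
      then show ?thesis by simp
    qed
    finally show ?thesis .
  qed
  have "quintuple_summand (z / q ^ N) q (2 * N) j =
     (1 - z * q powi k) * (qpoch q q (2 * N) / (qpoch q q j * qpoch q q a))
     * (qpoch (- q / z) q N * qpoch (- z) q (Suc N) / (qpoch (q / z\<^sup>2) q a * qpoch (z\<^sup>2) q (Suc j)))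
     * (z ^ N / (- (z\<^sup>2)) ^ a * (- (z / q ^ N)) ^ j)
     * (q ^ (\<Sum>{..a}) / q ^ (\<Sum>{..N}) * q ^ j\<^sup>2)"
    unfolding quintuple_summand_def 1 2 3 a_def[symmetric] by (simp add: mult_ac)
  also have "\<dots> = (1 - z * q powi k) * (qpoch q q (2 * N) / (qpoch q q j * qpoch q q a))
     * (qpoch (- q / z) q N * qpoch (- z) q (Suc N) / (qpoch (q / z\<^sup>2) q a * qpoch (z\<^sup>2) q (Suc j)))
     * z powi (3 * k) * (q ^ (\<Sum>{..a}) / q ^ (\<Sum>{..N}) / q ^ (N * j) * q ^ j\<^sup>2)"
    unfolding 4 by (simp add: mult_ac)
  finally show ?thesis
    unfolding 5 quintuple_series_term_def a_def[symmetric] k_def[symmetric] by (simp add: mult_ac)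
qed

text \<open>Pairing the indices at distance \<open>r\<close> from the middle turns the bilateral sum
  into a sum over natural numbers, to which Tannery's theorem applies.\<close>

lemma sum_symmetric_about_middle:
  fixes f :: "nat \<Rightarrow> 'a :: comm_monoid_add"
  shows "(\<Sum>j\<le>2 * N. f j) = (\<Sum>r\<le>N. if r = 0 then f N else f (N + r) + f (N - r))"
proof -
  have "(\<Sum>j\<le>2 * N. f j) = (\<Sum>j\<in>{N} \<union> {N<..2 * N} \<union> {..<N}. f j)"
    by (intro sum.cong) auto
  also have "\<dots> = f N + (\<Sum>j\<in>{N<..2 * N}. f j) + (\<Sum>j<N. f j)"
    by (subst sum.union_disjoint; (subst sum.union_disjoint)?) auto
  also have "(\<Sum>j\<in>{N<..2 * N}. f j) = (\<Sum>r\<in>{0<..N}. f (N + r))"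
    by (rule sum.reindex_bij_witness[of _ "\<lambda>r. N + r" "\<lambda>j. j - N"]) auto
  also have "(\<Sum>j<N. f j) = (\<Sum>r\<in>{0<..N}. f (N - r))"
    by (rule sum.reindex_bij_witness[of _ "\<lambda>r. N - r" "\<lambda>j. N - j"]) auto
  also have "f N + (\<Sum>r\<in>{0<..N}. f (N + r)) + (\<Sum>r\<in>{0<..N}. f (N - r))
      = f N + (\<Sum>r\<in>{0<..N}. if r = 0 then f N else f (N + r) + f (N - r))"
    by (simp add: sum.distrib[symmetric] add.assoc)
  also have "\<dots> = (\<Sum>r\<in>insert 0 {0<..N}. if r = 0 then f N else f (N + r) + f (N - r))"
    by (subst sum.insert) auto
  also have "insert 0 {0<..N} = {..N}" by auto
  finally show ?thesis .
qed

text \<open>The term is the \<open>r\<close>-th power of \<open>y * p ^ r\<close>, which is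
  eventually below 1/2.\<close>

lemma summable_power_times_power_square:
  fixes y p :: real
  assumes "0 \<le> y" "0 \<le> p" "p < 1"
  shows "summable (\<lambda>r. y ^ r * p ^ r\<^sup>2)"
proof (rule summable_comparison_test_ev)
  have "(\<lambda>r. y * p ^ r) \<longlonglongrightarrow> y * 0"
    using assms by (intro tendsto_mult tendsto_const LIMSEQ_power_zero) auto
  then have "\<forall>\<^sub>F r in sequentially. y * p ^ r < 1 / 2"
    by (rule order_tendstoD) auto
  then show "\<forall>\<^sub>F r in sequentially. norm (y ^ r * p ^ r\<^sup>2) \<le> (1 / 2) ^ r"
  proof eventually_elim
    case (elim r)
    have "y ^ r * p ^ r\<^sup>2 = (y * p ^ r) ^ r"
      by (simp add: power_mult_distrib power2_eq_square flip: power_mult)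
    moreover have "\<dots> \<le> (1 / 2) ^ r"
      using elim assms by (intro power_mono) auto
    ultimately show ?case using assms by simp
  qed
qed (simp add: summable_geometric)

text \<open>Both powers of \<open>q\<close> in the term have exponent at least
  \<open>k\<^sup>2\<close>, because the absolute value of an integer \<open>k\<close> is at most
  \<open>k\<^sup>2\<close>. This beats the geometric growth of
  \<open>z powi (3 * k)\<close>.\<close>

lemma summable_norm_quintuple_series_term:
  assumes q: "q \<noteq> 0" "norm q < 1" and z: "z \<noteq> 0"
  shows "summable (\<lambda>r. norm (quintuple_series_term z q (int r)))"
    and "summable (\<lambda>r. norm (quintuple_series_term z q (- int r)))"
proof -
  define p y where "p = norm q" and "y = norm z"
  have p: "0 < p" "p < 1" and y: "0 < y" using q z by (auto simp: p_def y_def)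
  have pow: "p powi m \<le> p ^ r\<^sup>2" if "m \<ge> int (r\<^sup>2)" for m r
    using power_int_decreasing[OF that, of p] p by (simp del: of_nat_power)
  have main: "norm (quintuple_series_term z q k) \<le> (1 + y) * (y powi (3 * k) * p ^ r\<^sup>2)" if "\<bar>k\<bar> = int r" for k r
  proof -
    have e: "int (r\<^sup>2) = k\<^sup>2" using that by (metis of_nat_power power2_abs)
    have "\<bar>k\<bar> \<le> k\<^sup>2" using that by (metis abs_le_square_iff abs_of_nat e of_nat_le_iff power2_nat_le_imp_le le_square power2_eq_square)
    then have "2 * k\<^sup>2 \<le> k * (3 * k - 1)" "2 * k\<^sup>2 \<le> k * (3 * k - 1) + 2 * k"
      by (auto simp: power2_eq_square algebra_simps)
    then have m: "int (r\<^sup>2) \<le> k * (3 * k - 1) div 2" "int (r\<^sup>2) \<le> k + k * (3 * k - 1) div 2"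
      unfolding e by auto
    have "quintuple_series_term z q k
        = z powi (3 * k) * (q powi (k * (3 * k - 1) div 2) - z * q powi (k + k * (3 * k - 1) div 2))"
      using q by (simp add: quintuple_series_term_def algebra_simps power_int_add)
    also have "norm \<dots> \<le> y powi (3 * k) * (p powi (k * (3 * k - 1) div 2) + y * p powi (k + k * (3 * k - 1) div 2))"
      using norm_triangle_ineq4 [of "q powi (k * (3 * k - 1) div 2)" "z * q powi (k + k * (3 * k - 1) div 2)"]
      by (auto simp: norm_mult norm_power_int p_def y_def intro!: mult_left_mono)
    also have "\<dots> \<le> y powi (3 * k) * (p ^ r\<^sup>2 + y * p ^ r\<^sup>2)"
      using y m by (intro mult_left_mono add_mono pow) auto
    finally show ?thesis by (simp add: algebra_simps)
  qed
  have "summable (\<lambda>r. (1 + y) * ((y ^ 3) ^ r * p ^ r\<^sup>2))"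
    using p y by (intro summable_mult summable_power_times_power_square) auto
  then show "summable (\<lambda>r. norm (quintuple_series_term z q (int r)))"
  proof (rule summable_comparison_test')
    show "norm (norm (quintuple_series_term z q (int r))) \<le> (1 + y) * ((y ^ 3) ^ r * p ^ r\<^sup>2)" for r
      using main[of "int r" r] by (simp add: power_int_mult)
  qed
  have "summable (\<lambda>r. (1 + y) * ((inverse y ^ 3) ^ r * p ^ r\<^sup>2))"
    using p y by (intro summable_mult summable_power_times_power_square) auto
  then show "summable (\<lambda>r. norm (quintuple_series_term z q (- int r)))"
  proof (rule summable_comparison_test')
    show "norm (norm (quintuple_series_term z q (- int r))) \<le> (1 + y) * ((inverse y ^ 3) ^ r * p ^ r\<^sup>2)" for r
      using main[of "- int r" r] by (simp add: power_int_mult power_int_minus power_inverse)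
  qed
qed

section \<open>The quintuple product identity\<close>

text \<open>Setting the terms to zero outside \<open>A n\<close> turns the finite sums into series.
  Each index eventually lies in \<open>A n\<close>, so the termwise limits are unchanged and
  Tannery's theorem applies.\<close>

lemma tannery_finite_sums:
  fixes a :: "nat \<Rightarrow> nat \<Rightarrow> 'a :: {real_normed_algebra, banach}"
  assumes limit: "\<And>r. (\<lambda>n. a r n) \<longlonglongrightarrow> b r"
    and bound: "\<And>r n. r \<in> A n \<Longrightarrow> norm (a r n) \<le> M r"
    and M: "summable M" "\<And>r. 0 \<le> M r"
    and A: "\<And>n. finite (A n)" "\<And>r. \<forall>\<^sub>F n in sequentially. r \<in> A n"
  shows "summable b" and "(\<lambda>n. \<Sum>r\<in>A n. a r n) \<longlonglongrightarrow> suminf b"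
proof -
  define a' where "a' r n = (if r \<in> A n then a r n else 0)" for r n
  have "(\<lambda>n. a' r n) \<longlonglongrightarrow> b r" for r
    by (rule Lim_transform_eventually[OF limit[of r]], use A(2)[of r] in eventually_elim) (simp add: a'_def)
  moreover have "\<forall>\<^sub>F (r, n) in at_top \<times>\<^sub>F sequentially. norm (a' r n) \<le> M r"
    using bound M(2) by (intro always_eventually) (auto simp: a'_def)
  ultimately have "summable (\<lambda>r. norm (b r)) \<and> (\<lambda>n. \<Sum>r. a' r n) \<longlonglongrightarrow> suminf b"
    using tannerys_theorem[of a' b sequentially M] M(1) by auto
  moreover have "(\<Sum>r. a' r n) = (\<Sum>r\<in>A n. a r n)" for n
    using A(1)[of n] by (subst suminf_finite[of "A n"]) (auto simp: a'_def)
  ultimately show "summable b" "(\<lambda>n. \<Sum>r\<in>A n. a r n) \<longlonglongrightarrow> suminf b"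
    by (auto intro: summable_norm_cancel)
qed

text \<open>The recentred finite identity says that the series terms, weighted by \<open>W\<close>
  and \<open>V\<close>, sum to 1. All weights tend to the same \<open>L\<close>, so dominated
  convergence gives the sum \<open>1 / L\<close>. Assumption \<open>zq\<close> ranges over integer
  exponents because the shift by \<open>q ^ N\<close> introduces negative ones.\<close>

theorem quintuple_product:
  fixes q z :: complex
  assumes q: "q \<noteq> 0" "norm q < 1" and z: "z \<noteq> 0" and zq: "\<And>k. z\<^sup>2 * q powi k \<noteq> 1"
  shows "(\<lambda>r. if r = 0 then 1 - z
              else quintuple_series_term z q (int r) + quintuple_series_term z q (- int r))
         sums (qpochs_inf [q, z, q / z] q * qpochs_inf [q * z\<^sup>2, q / z\<^sup>2] (q\<^sup>2))"
proof -
  define e where "e = quintuple_series_term z q"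
  define W where "W N = qpoch q q (2 * N) * qpoch (- q / z) q N * qpoch (- z) q (Suc N)" for N
  define V where "V a b = inverse (qpoch q q a) * inverse (qpoch q q b)
      * (inverse (qpoch (q / z\<^sup>2) q b) * inverse (qpoch (z\<^sup>2) q (Suc a)))" for a b
  define L where "L = qpoch_inf q q * qpoch_inf (- q / z) q * qpoch_inf (- z) q *
     (inverse (qpoch_inf q q) * inverse (qpoch_inf q q)
      * (inverse (qpoch_inf (q / z\<^sup>2) q) * inverse (qpoch_inf (z\<^sup>2) q)))"
  define s where "s r N = (if r = 0 then e 0 * W N * V N N
      else e (int r) * W N * V (N + r) (N - r) + e (- int r) * W N * V (N - r) (N + r))" for r N
  have nz: "z\<^sup>2 * q ^ j \<noteq> 1" "q / z\<^sup>2 * q ^ j \<noteq> 1" "q * q ^ j \<noteq> 1" for j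
    using zq[of "int j"] zq[of "- int (Suc j)"] z q power_neq_1_of_norm_less_1[OF q(2), of "Suc j"]
    by (auto simp: power_int_minus field_simps simp del: power_Suc of_nat_Suc) (auto simp: field_simps)
  \<comment> \<open>The squares of these quantities are among those excluded by
    \<open>nz\<close>.\<close>
  have nz': "- q / z * q ^ j \<noteq> 1" "- z * q ^ j \<noteq> 1" for j
  proof -
    have "z\<^sup>2 * (q ^ j)\<^sup>2 \<noteq> 1" using nz(1)[of "j * 2"] by (simp add: power_mult)
    then show "- z * q ^ j \<noteq> 1" by (metis power_mult_distrib power2_minus one_power2)
    have "q / z\<^sup>2 * q ^ (2 * j + 1) = (- q / z * q ^ j)\<^sup>2"
      by (simp add: power2_eq_square mult_2 power_add)
    then show "- q / z * q ^ j \<noteq> 1" using nz(2)[of "2 * j + 1"] by (metis one_power2)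
  qed
  have one: "(\<Sum>r\<le>N. s r N) = 1" for N
  proof -
    have "(\<Sum>j\<le>2 * N. quintuple_summand (z / q ^ N) q (2 * N) j) = 1"
    proof (rule finite_quintuple_product[OF q(2)])
      have "(z / q ^ N)\<^sup>2 * q ^ j = z\<^sup>2 * q powi (int j - int (N * 2))" for j
        using q by (simp add: power_int_diff power_divide power_mult del: of_nat_mult)
      then show "(z / q ^ N)\<^sup>2 * q ^ j \<noteq> 1" for j using zq by metis
    qed
    moreover have terms: "(if r = 0 then quintuple_summand (z / q ^ N) q (2 * N) N
        else quintuple_summand (z / q ^ N) q (2 * N) (N + r) + quintuple_summand (z / q ^ N) q (2 * N) (N - r)) = s r N"
      if "r \<le> N" for r
    proof -
      have shift: "quintuple_summand (z / q ^ N) q (2 * N) j = e (int j - int N) * W N * V j (2 * N - j)"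
        if "j \<le> 2 * N" for j
        using quintuple_summand_shifted[OF q(1) z that] by (simp add: e_def W_def V_def divide_inverse)
      have "2 * N - (N + r) = N - r" "2 * N - (N - r) = N + r" using that by auto
      then show ?thesis using shift[of N] shift[of "N + r"] shift[of "N - r"] that
        by (simp add: s_def)
    qed
    ultimately show ?thesis
      unfolding sum_symmetric_about_middle
      by (subst (asm) sum.cong[OF refl terms]) auto
  qed
  have W: "W \<longlonglongrightarrow> qpoch_inf q q * qpoch_inf (- q / z) q * qpoch_inf (- z) q"
    unfolding W_def
    by (intro tendsto_mult qpoch_tendsto[OF q(2)]
          filterlim_compose[OF qpoch_tendsto[OF q(2)]] filterlim_subseq)
       (auto simp: strict_mono_def)
  have lim_inv: "(\<lambda>N. inverse (qpoch a q (f N))) \<longlonglongrightarrow> inverse (qpoch_inf a q)"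
    if "filterlim f sequentially sequentially" "\<And>j. a * q ^ j \<noteq> 1" for a f
    by (intro tendsto_inverse filterlim_compose[OF qpoch_tendsto[OF q(2)]] qpoch_inf_nonzero that q)
  have lim_V: "(\<lambda>N. W N * V (f N) (g N)) \<longlonglongrightarrow> L"
    if "filterlim f sequentially sequentially" "filterlim g sequentially sequentially" for f g
    unfolding V_def L_def using that
    by (intro tendsto_mult lim_inv W nz filterlim_compose[OF filterlim_Suc]) auto
  have plus: "filterlim (\<lambda>N. N + r) sequentially sequentially" for r :: nat
    by (rule filterlim_add_const_nat_at_top)
  have minus: "filterlim (\<lambda>N. N - r) sequentially sequentially" for r :: nat
    by (rule filterlim_minus_const_nat_at_top)
  define b where "b r = (if r = 0 then e 0 else e (int r) + e (- int r))" for r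
  have lim_s: "(\<lambda>N. s r N) \<longlonglongrightarrow> b r * L" for r
  proof (cases "r = 0")
    case True
    have "(\<lambda>N. e 0 * (W N * V N N)) \<longlonglongrightarrow> e 0 * L"
      by (intro tendsto_mult tendsto_const lim_V filterlim_ident)
    with True show ?thesis by (simp add: s_def b_def mult_ac)
  next
    case False
    have "(\<lambda>N. e (int r) * (W N * V (N + r) (N - r)) + e (- int r) * (W N * V (N - r) (N + r)))
        \<longlonglongrightarrow> e (int r) * L + e (- int r) * L"
      by (intro tendsto_add tendsto_mult[OF tendsto_const] lim_V plus minus)
    with False show ?thesis by (simp add: s_def b_def algebra_simps)
  qed
  \<comment> \<open>The bound is uniform in all three indices: \<open>W\<close> converges, and each
    reciprocal in \<open>V\<close> is bounded on its own.\<close>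
  obtain K where K: "norm (W N * V m n) \<le> K" for N m n
  proof -
    obtain C1 where C1: "C1 > 0" "\<And>n. norm (inverse (qpoch q q n)) \<le> C1"
      by (rule qpoch_inverse_bounded[OF q(2) nz(3)]) blast
    obtain C2 where C2: "C2 > 0" "\<And>n. norm (inverse (qpoch (q / z\<^sup>2) q n)) \<le> C2"
      by (rule qpoch_inverse_bounded[OF q(2) nz(2)]) blast
    obtain C3 where C3: "C3 > 0" "\<And>n. norm (inverse (qpoch (z\<^sup>2) q n)) \<le> C3"
      by (rule qpoch_inverse_bounded[OF q(2) nz(1)]) blast
    have "Bseq W" using W convergent_imp_Bseq convergentI by blast
    then obtain C4 where C4: "C4 > 0" "\<And>n. norm (W n) \<le> C4" unfolding Bseq_def by blast
    have "norm (W N * V m n) \<le> C4 * (C1 * C1 * (C2 * C3))" for N m n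
      unfolding norm_mult V_def using C1 C2 C3 C4
      by (intro mult_mono) (auto intro!: mult_nonneg_nonneg less_imp_le)
    then show ?thesis using that by blast
  qed
  have K0: "0 \<le> K" using K norm_ge_zero order_trans by blast
  define M where "M r = (norm (e (int r)) + norm (e (- int r))) * K" for r
  have M: "summable M" unfolding M_def e_def
    by (intro summable_mult2 summable_add summable_norm_quintuple_series_term q z)
  have bound: "norm (s r N) \<le> M r" for r N
  proof -
    have b1: "norm (e k * W N * V m n) \<le> norm (e k) * K" for k m n
      using mult_left_mono[OF K[of N m n], of "norm (e k)"] by (simp add: norm_mult mult_ac)
    show ?thesis
    proof (cases "r = 0")
      case True
      have "0 \<le> norm (e 0) * K" using K0 by simp
      with True show ?thesis using b1[of 0 N N] by (simp add: s_def M_def distrib_right)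
    next
      case False
      then show ?thesis
        using b1[of "int r" "N + r" "N - r"] b1[of "- int r" "N - r" "N + r"]
        by (auto simp: s_def M_def distrib_right intro: norm_triangle_le)
    qed
  qed
  have bL: "summable (\<lambda>r. b r * L)" "(\<lambda>N. \<Sum>r\<in>{..N}. s r N) \<longlonglongrightarrow> (\<Sum>r. b r * L)"
    by (rule tannery_finite_sums[where A = "\<lambda>N. {..N}", OF lim_s bound M];
        simp add: M_def K0 eventually_ge_at_top)+
  have "(\<Sum>r. b r * L) = 1"
    by (rule LIMSEQ_unique[OF bL(2)[unfolded one] tendsto_const])
  with bL(1) have bL_sums: "(\<lambda>r. b r * L) sums 1"
    by (metis summable_sums)
  have inf_nz: "qpoch_inf q q \<noteq> 0" "qpoch_inf (q / z\<^sup>2) q \<noteq> 0" "qpoch_inf (z\<^sup>2) q \<noteq> 0"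
      "qpoch_inf (- q / z) q \<noteq> 0" "qpoch_inf (- z) q \<noteq> 0"
    by (intro qpoch_inf_nonzero q nz nz')+
  then have "L \<noteq> 0" by (simp add: L_def)
  then have "b sums (1 / L)"
    using sums_mult2[OF bL_sums, of "1 / L"] by simp
  \<comment> \<open>The products in \<open>z\<^sup>2\<close> and \<open>q / z\<^sup>2\<close> split
    by the parity of the index. In each, one half factors further by
    \<open>qpoch_inf_mult_uminus\<close>, and the factors with \<open>- z\<close> and
    \<open>- q / z\<close> cancel.\<close>
  moreover have "1 / L = qpochs_inf [q, z, q / z] q * qpochs_inf [q * z\<^sup>2, q / z\<^sup>2] (q\<^sup>2)"
  proof -
    have "qpoch_inf (z\<^sup>2) q = qpoch_inf z q * qpoch_inf (- z) q * qpoch_inf (q * z\<^sup>2) (q\<^sup>2)"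
      using qpoch_inf_even_odd[OF q(2), of "z\<^sup>2"] qpoch_inf_mult_uminus[OF q(2), of z]
      by (simp add: mult_ac)
    moreover have "qpoch_inf (q / z\<^sup>2) q
        = qpoch_inf (q / z\<^sup>2) (q\<^sup>2) * (qpoch_inf (q / z) q * qpoch_inf (- q / z) q)"
      using qpoch_inf_even_odd[OF q(2), of "q / z\<^sup>2"] qpoch_inf_mult_uminus[OF q(2), of "q / z"]
      by (simp add: power_divide power2_eq_square)
    moreover have "1 / (A * B * C * (inverse A * inverse A * (inverse (G * (D * B)) * inverse (E * C * F))))
        = A * (E * D) * (F * G)" if "A \<noteq> 0" "B \<noteq> 0" "C \<noteq> 0" for A B C D E F G :: complex
      using that by (simp add: inverse_eq_divide)
    ultimately show ?thesis
      using inf_nz by (simp add: L_def qpochs_inf_def mult.assoc)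
  qed
  moreover have "b = (\<lambda>r. if r = 0 then 1 - z else e (int r) + e (- int r))"
    by (auto simp: b_def e_def quintuple_series_term_def)
  ultimately show ?thesis unfolding e_def by simp
qed

section \<open>The limiting case of Bailey's lemma\<close>

definition durfee_summand :: "complex \<Rightarrow> nat \<Rightarrow> nat \<Rightarrow> complex" where
  "durfee_summand q c k = q ^ (k\<^sup>2 + c * k) * inverse (qpoch q q k) * inverse (qpoch q q (k + c))"

text \<open>The exponent \<open>k\<^sup>2 + c * k\<close> is at least \<open>k\<close>. Uniformity
  in \<open>c\<close> is the point: it permits the limit in \<open>c\<close> and bounds all inner
  sums of Bailey's lemma at once.\<close>

lemma durfee_summand_bound:
  assumes "norm q < 1"
  obtains B where "B > 0" "\<And>c k. norm (durfee_summand q c k) \<le> B * norm q ^ k"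
proof -
  obtain C where C: "C > 0" "\<And>n. norm (inverse (qpoch q q n)) \<le> C"
  proof -
    have nz: "q * q ^ j \<noteq> 1" for j
      using power_neq_1_of_norm_less_1[OF assms, of "Suc j"] by simp
    show ?thesis by (rule qpoch_inverse_bounded[OF assms nz]) (rule that)
  qed
  have "norm (durfee_summand q c k) \<le> norm q ^ k * C * C" for c k
  proof -
    have "k \<le> k\<^sup>2 + c * k" by (cases k) (auto simp: power2_eq_square)
    then have "norm q ^ (k\<^sup>2 + c * k) \<le> norm q ^ k"
      using assms by (intro power_decreasing) auto
    then show ?thesis unfolding durfee_summand_def norm_mult norm_power
      using C by (intro mult_mono) (auto intro!: mult_nonneg_nonneg less_imp_le)
  qed
  then have "norm (durfee_summand q c k) \<le> (C * C) * norm q ^ k" for c k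
    by (simp add: mult_ac)
  with that[of "C * C"] C(1) show ?thesis by simp
qed

text \<open>
  The sum \<open>F c\<close> does not depend on \<open>c\<close> because its difference \<open>D c = F c - F (c + 1)\<close> satisfies
  \<open>D c = - q\<^sup>c\<^sup>+\<^sup>1 D (c + 1)\<close> and is bounded; letting \<open>c\<close> tend to infinity then isolates the
  term \<open>k = 0\<close>.
\<close>
lemma durfee_rectangle_sums:
  assumes q: "norm q < 1"
  shows "durfee_summand q c sums inverse (qpoch_inf q q)"
proof -
  obtain B where B: "B > 0" "\<And>c k. norm (durfee_summand q c k) \<le> B * norm q ^ k"
    by (rule durfee_summand_bound[OF q]) blast
  define F where "F c = suminf (durfee_summand q c)" for c
  have geo: "summable (\<lambda>k. B * norm q ^ k)"
    using q by (intro summable_mult summable_geometric) simp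
  have sm: "summable (durfee_summand q c)" for c
    by (rule summable_comparison_test'[OF geo, of 0]) (use B in auto)
  then have F: "durfee_summand q c sums F c" for c by (simp add: F_def summable_sums)
  have F_bound: "norm (F c) \<le> (\<Sum>k. B * norm q ^ k)" for c
    unfolding F_def by (rule norm_suminf_le[OF _ geo]) (use B in auto)
  have nz: "qpoch q q m \<noteq> 0" for m by (rule qpoch_self_nonzero[OF q])
  have rec: "F c - F (Suc c) = - (q ^ Suc c) * (F (Suc c) - F (Suc (Suc c)))" for c
  proof -
    \<comment> \<open>Over a common denominator, the difference of the summands for \<open>c\<close>
      and \<open>Suc c\<close> has numerator \<open>1 - q ^ k - q ^ Suc (k + c)\<close>, up to a
      power of \<open>q\<close>. The part \<open>1 - q ^ k\<close> vanishes at \<open>k = 0\<close>,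
      and an index shift turns it into the series for \<open>Suc (Suc c)\<close>.\<close>
    define w where "w k = q ^ (k\<^sup>2 + c * k) * inverse (qpoch q q k) * inverse (qpoch q q (k + Suc c)) * (1 - q ^ k)" for k
    have w_Suc: "w (Suc k) = q ^ Suc c * durfee_summand q (Suc (Suc c)) k" for k
    proof -
      have n: "1 - q ^ Suc k \<noteq> 0" using power_neq_1_of_norm_less_1[OF q, of "Suc k"] by simp
      have "(Suc k)\<^sup>2 + c * Suc k = Suc c + (k\<^sup>2 + Suc (Suc c) * k)"
        by (simp add: power2_eq_square)
      moreover have "inverse (qpoch q q (Suc k)) * (1 - q ^ Suc k) = inverse (qpoch q q k)"
        using n by (simp add: qpoch_Suc)
      ultimately show ?thesis
        by (simp add: w_def durfee_summand_def power_add mult_ac del: power_Suc)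
           (simp add: power_add mult_ac)
    qed
    have "w sums (q ^ Suc c * F (Suc (Suc c)) + w 0)"
      unfolding sums_Suc_iff[symmetric] w_Suc by (intro sums_mult F)
    then have "w sums (q ^ Suc c * F (Suc (Suc c)))" by (simp add: w_def)
    moreover have "w k - q ^ Suc c * durfee_summand q (Suc c) k
        = durfee_summand q c k - durfee_summand q (Suc c) k" for k
    proof -
      have n: "1 - q ^ Suc (k + c) \<noteq> 0" using power_neq_1_of_norm_less_1[OF q, of "Suc (k + c)"] by simp
      have 1: "inverse (qpoch q q (k + c)) = inverse (qpoch q q (k + Suc c)) * (1 - q ^ Suc (k + c))"
        using n by (simp add: qpoch_Suc)
      show ?thesis
        unfolding w_def durfee_summand_def 1 by (simp add: algebra_simps power_add)
    qed
    ultimately have 1: "(\<lambda>k. durfee_summand q c k - durfee_summand q (Suc c) k)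
        sums (q ^ Suc c * F (Suc (Suc c)) - q ^ Suc c * F (Suc c))"
      using sums_diff[of w _ "\<lambda>k. q ^ Suc c * durfee_summand q (Suc c) k", OF _ sums_mult[OF F]]
      by (simp only:)
    have 2: "(\<lambda>k. durfee_summand q c k - durfee_summand q (Suc c) k) sums (F c - F (Suc c))"
      by (intro sums_diff F)
    show ?thesis
      using sums_unique2[OF 2 1] by (simp only: right_diff_distrib mult_minus_left) simp
  qed
  have "F c = F (Suc c)" for c
  proof -
    define S where "S = (\<Sum>k. B * norm q ^ k)"
    have "norm (F c - F (Suc c)) \<le> norm q ^ n * (2 * S)" for n
    proof -
      have "norm (F c - F (Suc c)) \<le> norm q ^ n * norm (F (c + n) - F (Suc (c + n)))"
      proof (induction n)
        case (Suc n)
        have "norm (F (c + n) - F (Suc (c + n)))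
            = norm q ^ Suc (c + n) * norm (F (c + Suc n) - F (Suc (c + Suc n)))"
          by (subst rec) (simp add: norm_mult norm_power)
        also have "\<dots> \<le> norm q ^ 1 * norm (F (c + Suc n) - F (Suc (c + Suc n)))"
          using q by (intro mult_right_mono power_decreasing) auto
        finally have "norm q ^ n * norm (F (c + n) - F (Suc (c + n)))
            \<le> norm q ^ n * (norm q ^ 1 * norm (F (c + Suc n) - F (Suc (c + Suc n))))"
          by (rule mult_left_mono) simp
        with Suc show ?case by (simp add: mult_ac)
      qed simp
      also have "norm (F (c + n) - F (Suc (c + n))) \<le> 2 * S"
        using norm_triangle_ineq4[of "F (c + n)" "F (Suc (c + n))"] F_bound[of "c + n"] F_bound[of "Suc (c + n)"]
        by (simp add: S_def)
      finally show ?thesis by (simp add: mult_left_mono)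
    qed
    moreover have "(\<lambda>n. norm q ^ n * (2 * S)) \<longlonglongrightarrow> 0 * (2 * S)"
      using q by (intro tendsto_mult tendsto_const LIMSEQ_power_zero) auto
    ultimately have "norm (F c - F (Suc c)) \<le> 0 * (2 * S)"
      by (intro LIMSEQ_le_const) auto
    then show ?thesis by simp
  qed
  then have const: "F c = F 0" for c by (induction c) auto
  define b where "b k = (if k = 0 then inverse (qpoch_inf q q) else 0)" for k :: nat
  have inv_lim: "(\<lambda>n. inverse (qpoch q q (k + n))) \<longlonglongrightarrow> inverse (qpoch_inf q q)" for k
    unfolding add.commute[of k]
    by (intro tendsto_inverse filterlim_compose[OF qpoch_tendsto[OF q]] filterlim_add_const_nat_at_top
          qpoch_self_inf_nonzero q)
  have lim: "(\<lambda>n. durfee_summand q n k) \<longlonglongrightarrow> b k" for k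
  proof (cases "k = 0")
    case True
    with inv_lim[of 0] show ?thesis by (simp add: durfee_summand_def b_def)
  next
    case False
    have "(\<lambda>n. q ^ k\<^sup>2 * (q ^ k) ^ n * inverse (qpoch q q k) * inverse (qpoch q q (k + n)))
        \<longlonglongrightarrow> q ^ k\<^sup>2 * 0 * inverse (qpoch q q k) * inverse (qpoch_inf q q)"
      using False q
      by (intro tendsto_mult tendsto_const inv_lim LIMSEQ_power_zero) (auto simp: norm_power power_less_one_iff)
    with False show ?thesis
      by (simp add: durfee_summand_def b_def power_add mult.commute[of _ k] flip: power_mult)
  qed
  have "\<forall>\<^sub>F (k, n) in at_top \<times>\<^sub>F sequentially. norm (durfee_summand q n k) \<le> B * norm q ^ k"
    using B(2) by (intro always_eventually) auto
  then have "(\<lambda>n. F n) \<longlonglongrightarrow> suminf b"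
    unfolding F_def 
    using tannerys_theorem[of "\<lambda>k n. durfee_summand q n k" b, OF lim _ geo] by simp
  moreover have "suminf b = inverse (qpoch_inf q q)"
    unfolding b_def by (subst suminf_finite[of "{0}"]) auto
  moreover have "(\<lambda>n. F n) \<longlonglongrightarrow> F 0"
    by (rule Lim_transform_eventually[OF tendsto_const]) (intro always_eventually allI const[symmetric])
  ultimately have "F 0 = inverse (qpoch_inf q q)"
    using LIMSEQ_unique by metis
  with F[of c] const[of c] show ?thesis by simp
qed

section \<open>Rearranging the truncated double sum\<close>

lemma sum_triangle_Sigma:
  fixes f :: "nat \<Rightarrow> nat \<Rightarrow> 'a :: comm_monoid_add"
  shows "(\<Sum>n<H. \<Sum>s\<le>n. f s (n - s)) = (\<Sum>s<H. \<Sum>k<H - s. f s k)"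
proof -
  have "(\<Sum>n<H. \<Sum>s\<le>n. f s (n - s)) = (\<Sum>(s, k)\<in>{(s, k). s + k < H}. f s k)"
    by (rule sum.triangle_reindex[symmetric])
  also have "{(s, k). s + k < H} = Sigma {..<H} (\<lambda>s. {..<H - s})" by auto
  also have "(\<Sum>(s, k)\<in>\<dots>. f s k) = (\<Sum>s<H. \<Sum>k<H - s. f s k)"
    by (rule sum.Sigma[symmetric]) auto
  finally show ?thesis .
qed

text \<open>The case \<open>m = 0\<close> is separate because \<open>3 * m - 1\<close> would
  truncate to 0 and count \<open>f 0\<close> twice.\<close>

definition triple :: "(nat \<Rightarrow> complex) \<Rightarrow> nat \<Rightarrow> complex" where
  "triple f m = (if m = 0 then 0 else f (3 * m - 1)) + f (3 * m) + f (3 * m + 1)"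

text \<open>The last group, \<open>m = M - 1\<close>, ends at index \<open>3 * M - 2\<close>; for
  \<open>M = 0\<close> truncated subtraction gives the empty sum.\<close>

lemma sum_triple: "(\<Sum>m<M. triple f m) = (\<Sum>n<3 * M - 1. f n)"
proof (induction M)
  case (Suc M)
  show ?case
  proof (cases M)
    case (Suc k)
    then obtain m where "3 * Suc M - 1 = Suc (Suc (Suc m))" "3 * M - 1 = m" "3 * M = Suc m"
      "3 * M + 1 = Suc (Suc m)"
      by (intro that[of "3 * k + 2"]) simp_all
    then have "(\<Sum>n<3 * Suc M - 1. f n) = (\<Sum>n<3 * M - 1. f n) + f (3 * M - 1) + f (3 * M) + f (3 * M + 1)"
      by (simp only: sum.lessThan_Suc)
    moreover have "triple f M = f (3 * M - 1) + f (3 * M) + f (3 * M + 1)"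
      using Suc by (simp add: triple_def)
    ultimately show ?thesis
      using Suc.IH by (simp only: sum.lessThan_Suc add.assoc)
  qed (simp add: triple_def numeral_2_eq_2)
qed simp

text \<open>Bailey's lemma before the limit. With \<open>n = s + k\<close> one has
  \<open>n\<^sup>2 = s\<^sup>2 + (k\<^sup>2 + 2 * s * k)\<close> and
  \<open>n + s = k + 2 * s\<close>, so the inner sums are partial sums of the Durfee rectangle
  series with \<open>c = 2 * s\<close>.\<close>

lemma sum_power_times_bailey_beta:
  "(\<Sum>n<H. q ^ n\<^sup>2 * bailey_beta l q (int n))
     = (\<Sum>s<H. q ^ s\<^sup>2 * bailey_alpha l q s * (\<Sum>k<H - s. durfee_summand q (2 * s) k))"
proof -
  define f where "f s k = q ^ s\<^sup>2 * bailey_alpha l q s * durfee_summand q (2 * s) k" for s k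
  have "q ^ n\<^sup>2 * bailey_beta l q (int n) = (\<Sum>s\<le>n. f s (n - s))" for n
  proof -
    have "q ^ n\<^sup>2 * (bailey_alpha l q s / (qpoch q q (n - s) * qpoch q q (n + s))) = f s (n - s)"
      if "s \<le> n" for s
    proof -
      define k where "k = n - s"
      have n: "n = s + k" using that by (simp add: k_def)
      have 1: "q ^ n\<^sup>2 = q ^ s\<^sup>2 * q ^ (k\<^sup>2 + 2 * s * k)"
        unfolding power_add[symmetric] n by (simp add: power2_sum add.assoc)
      have 2: "n + s = k + 2 * s" using n by simp
      show ?thesis
        unfolding 1 2 k_def[symmetric] f_def durfee_summand_def by (simp add: divide_inverse mult_ac)
    qed
    then have "(\<Sum>s\<le>n. q ^ n\<^sup>2 * (bailey_alpha l q s / (qpoch q q (n - s) * qpoch q q (n + s))))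
        = (\<Sum>s\<le>n. f s (n - s))"
      by (intro sum.cong) auto
    then show ?thesis
      by (simp add: bailey_beta_def sum_distrib_left atLeast0AtMost)
  qed
  then have "(\<Sum>n<H. q ^ n\<^sup>2 * bailey_beta l q (int n)) = (\<Sum>s<H. \<Sum>k<H - s. f s k)"
    by (simp only: sum_triangle_Sigma)
  then show ?thesis by (simp only: f_def sum_distrib_left)
qed

section \<open>The Bailey pair\<close>

text \<open>The two powers in \<alpha> at \<open>3 * r\<close> are the leading powers of the series
  terms at \<open>r\<close> and \<open>- r\<close>; the values at \<open>3 * r + 1\<close> and
  \<open>3 * r - 1\<close> supply their subtracted powers, in this order.\<close>

lemma bailey_alpha_quintuple:
  assumes q: "q \<noteq> 0"
  shows "triple (\<lambda>s. q ^ s\<^sup>2 * bailey_alpha l q s) r =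
    (if r = 0 then 1 - q\<^sup>2
     else quintuple_series_term (q\<^sup>2) (q ^ (l + 3)) (int r) + quintuple_series_term (q\<^sup>2) (q ^ (l + 3)) (- int r))"
proof (cases "r = 0")
  case True
  have "q * bailey_alpha l q (Suc 0) = - (q\<^sup>2)"
    using bailey_alpha_eqs(3)[of l q 0] by (simp add: power2_eq_square)
  with True show ?thesis by (simp add: triple_def bailey_alpha_eqs(1))
next
  case False
  define L R where "L = int l" and "R = int r"
  have series_term: "quintuple_series_term (q\<^sup>2) (q ^ (l + 3)) k
      = q powi (6 * k + (L + 3) * (k * (3 * k - 1) div 2))
        - q powi (2 + (L + 3) * k + 6 * k + (L + 3) * (k * (3 * k - 1) div 2))" for k
    using q by (simp add: quintuple_series_term_def L_def power_int_power power_int_add left_diff_distrib)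
  have sq: "q ^ n\<^sup>2 = q powi (int n)\<^sup>2" for n
    by (metis of_nat_power power_int_of_nat)
  have ints: "int (3 * r) = 3 * R" "int (3 * r + 1) = 3 * R + 1" "int (3 * r - 1) = 3 * R - 1"
    using False by (auto simp: R_def)
  \<comment> \<open>All divisions by 2 are exact, so the exponent identities are verified after
    doubling.\<close>
  have half: "x = y" if "2 * x = 2 * y" for x y :: int using that by simp
  have ev: "2 * ((3 * (L - 3) * R\<^sup>2 - (9 - L) * R) div 2) = 3 * (L - 3) * R\<^sup>2 - (9 - L) * R"
    "2 * ((3 * (L - 3) * R\<^sup>2 + (9 - L) * R) div 2) = 3 * (L - 3) * R\<^sup>2 + (9 - L) * R"
    "2 * ((3 * (L - 3) * R\<^sup>2 + (L + 3) * R) div 2) = 3 * (L - 3) * R\<^sup>2 + (L + 3) * R"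
    "2 * ((3 * (L - 3) * R\<^sup>2 - (L + 3) * R) div 2) = 3 * (L - 3) * R\<^sup>2 - (L + 3) * R"
    "2 * (k * (3 * k - 1) div 2) = k * (3 * k - 1)" for k :: int
    by (intro even_two_times_div_two; simp add: bailey_alpha_exponents_even)+
  have e1: "(3 * R)\<^sup>2 + (3 * (L - 3) * R\<^sup>2 - (9 - L) * R) div 2
      = 6 * (- R) + (L + 3) * ((- R) * (3 * (- R) - 1) div 2)"
    by (rule half, simp only: distrib_left mult.left_commute[of 2] ev)
       (simp add: power2_eq_square algebra_simps)
  have e2: "(3 * R)\<^sup>2 + (3 * (L - 3) * R\<^sup>2 + (9 - L) * R) div 2
      = 6 * R + (L + 3) * (R * (3 * R - 1) div 2)"
    by (rule half, simp only: distrib_left mult.left_commute[of 2] ev)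
       (simp add: power2_eq_square algebra_simps)
  have e3: "(3 * R + 1)\<^sup>2 + ((3 * (L - 3) * R\<^sup>2 + (L + 3) * R) div 2 + 1)
      = 2 + (L + 3) * R + 6 * R + (L + 3) * (R * (3 * R - 1) div 2)"
    by (rule half, simp only: distrib_left mult.left_commute[of 2] ev)
       (simp add: power2_eq_square algebra_simps)
  have e4: "(3 * R - 1)\<^sup>2 + ((3 * (L - 3) * R\<^sup>2 - (L + 3) * R) div 2 + 1)
      = 2 + (L + 3) * (- R) + 6 * (- R) + (L + 3) * ((- R) * (3 * (- R) - 1) div 2)"
    by (rule half, simp only: distrib_left mult.left_commute[of 2] ev)
       (simp add: power2_eq_square algebra_simps)
  have r: "r \<ge> 1" using False by simp
  have "triple (\<lambda>s. q ^ s\<^sup>2 * bailey_alpha l q s) r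
      = - (q powi ((3 * R - 1)\<^sup>2 + ((3 * (L - 3) * R\<^sup>2 - (L + 3) * R) div 2 + 1)))
        + (q powi ((3 * R)\<^sup>2 + (3 * (L - 3) * R\<^sup>2 - (9 - L) * R) div 2)
         + q powi ((3 * R)\<^sup>2 + (3 * (L - 3) * R\<^sup>2 + (9 - L) * R) div 2))
        - q powi ((3 * R + 1)\<^sup>2 + ((3 * (L - 3) * R\<^sup>2 + (L + 3) * R) div 2 + 1))"
    unfolding triple_def bailey_alpha_eqs(2)[OF r] bailey_alpha_eqs(3) bailey_alpha_eqs(4)[OF r] sq ints
      L_def[symmetric] R_def[symmetric]
    using False q by (simp only: power_int_add[OF disjI1[OF q]] if_False distrib_left) simp
  then show ?thesis
    unfolding e1 e2 e3 e4 R_def[symmetric] series_term using False by simp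
qed

text \<open>For \<open>l = 2\<close> the exponents in \<alpha> tend to minus infinity; adding
  \<open>s\<^sup>2\<close> lifts each of them to at least \<open>r\<close>. The factor 2 allows for
  the two powers at \<open>3 * r\<close>.\<close>

lemma norm_power_times_bailey_alpha_le:
  assumes l: "l \<ge> 2" and q: "q \<noteq> 0" "norm q < 1"
    and s: "s \<in> {3 * r, 3 * r + 1} \<or> (r \<ge> 1 \<and> s = 3 * r - 1)"
  shows "norm (q ^ s\<^sup>2 * bailey_alpha l q s) \<le> 2 * norm q ^ r"
proof (cases "r = 0")
  case True
  then have "s = 0 \<or> s = Suc 0" using s by auto
  then show ?thesis
    using True q bailey_alpha_eqs(3)[of l q 0] mult_le_one[of "norm q" "norm q"]
    by (auto simp: bailey_alpha_eqs(1) norm_mult)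
next
  case False
  define L R where "L = int l" and "R = int r"
  have L: "L \<ge> 2" and R: "R \<ge> 1" using l False by (auto simp: L_def R_def)
  have pw: "norm (q powi e) \<le> norm q ^ r" if "e \<ge> R" for e
    using power_int_decreasing[OF that, of "norm q"] q by (simp add: R_def norm_power_int)
  have sq: "q ^ n\<^sup>2 = q powi (int n)\<^sup>2" for n
    by (metis of_nat_power power_int_of_nat)
  have r: "r \<ge> 1" using False by simp
  have half: "c \<le> a div 2" if "2 * c \<le> a" for a c :: int using that by simp
  \<comment> \<open>With \<open>sqR\<close>, these are the facts that linear arithmetic needs once
    \<open>L * (R * R)\<close>, \<open>R * R\<close> and \<open>L * R\<close> are treated as
    atoms.\<close>
  have mono: "L * R \<le> L * (R * R)" "2 * R \<le> L * R"
    using L R by (auto simp: mult_le_cancel_left)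
  have "0 \<le> (R - 1) * (R - 1)" by simp
  then have sqR: "2 * R \<le> R * R + 1" by (simp add: algebra_simps)
  consider "s = 3 * r" | "s = 3 * r + 1" | "s = 3 * r - 1" using s by auto
  then show ?thesis
  proof cases
    case 1
    have "3 * (L - 3) * R\<^sup>2 - (9 - L) * R - 2 * (R - (3 * R)\<^sup>2)
        = 3 * (L * (R * R)) + 9 * (R * R) + L * R - 11 * R"
      "3 * (L - 3) * R\<^sup>2 + (9 - L) * R - 2 * (R - (3 * R)\<^sup>2)
        = 3 * (L * (R * R)) + 9 * (R * R) - L * R + 7 * R"
      by (simp_all add: power2_eq_square algebra_simps)
    then have "2 * (R - (3 * R)\<^sup>2) \<le> 3 * (L - 3) * R\<^sup>2 - (9 - L) * R"
      "2 * (R - (3 * R)\<^sup>2) \<le> 3 * (L - 3) * R\<^sup>2 + (9 - L) * R"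
      using mono sqR R by linarith+
    then have e: "(3 * R)\<^sup>2 + (3 * (L - 3) * R\<^sup>2 - (9 - L) * R) div 2 \<ge> R"
      "(3 * R)\<^sup>2 + (3 * (L - 3) * R\<^sup>2 + (9 - L) * R) div 2 \<ge> R"
      by (auto dest!: half)
    have "q ^ s\<^sup>2 * bailey_alpha l q s = q powi ((3 * R)\<^sup>2 + (3 * (L - 3) * R\<^sup>2 - (9 - L) * R) div 2)
         + q powi ((3 * R)\<^sup>2 + (3 * (L - 3) * R\<^sup>2 + (9 - L) * R) div 2)"
      unfolding 1 bailey_alpha_eqs(2)[OF r] sq L_def[symmetric] R_def[symmetric]
      using q by (simp add: power_int_add R_def distrib_left)
    then show ?thesis
      using add_mono[OF pw[OF e(1)] pw[OF e(2)]] by (simp only: mult_2) (rule norm_triangle_le)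
  next
    case 2
    have "3 * (L - 3) * R\<^sup>2 + (L + 3) * R - 2 * (R - (3 * R + 1)\<^sup>2 - 1)
        = 3 * (L * (R * R)) + 9 * (R * R) + L * R + 13 * R + 4"
      by (simp add: power2_eq_square algebra_simps)
    then have "2 * (R - (3 * R + 1)\<^sup>2 - 1) \<le> 3 * (L - 3) * R\<^sup>2 + (L + 3) * R"
      using mono sqR R by linarith
    then have e: "(3 * R + 1)\<^sup>2 + ((3 * (L - 3) * R\<^sup>2 + (L + 3) * R) div 2 + 1) \<ge> R"
      by (auto dest!: half)
    have "q ^ s\<^sup>2 * bailey_alpha l q s = - (q powi ((3 * R + 1)\<^sup>2 + ((3 * (L - 3) * R\<^sup>2 + (L + 3) * R) div 2 + 1)))"
      unfolding 2 bailey_alpha_eqs(3) sq L_def[symmetric] R_def[symmetric]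
      by (simp only: power_int_add[OF disjI1[OF q(1)]]) (simp add: R_def add.commute)
    with pw[OF e] show ?thesis
      by (simp add: order_trans[OF _ mult_right_mono[of 1 2]])
  next
    case 3
    have "3 * (L - 3) * R\<^sup>2 - (L + 3) * R - 2 * (R - (3 * R - 1)\<^sup>2 - 1)
        = 3 * (L * (R * R)) + 9 * (R * R) - L * R - 17 * R + 4"
      by (simp add: power2_eq_square algebra_simps)
    then have "2 * (R - (3 * R - 1)\<^sup>2 - 1) \<le> 3 * (L - 3) * R\<^sup>2 - (L + 3) * R"
      using mono sqR R by linarith
    then have e: "(3 * R - 1)\<^sup>2 + ((3 * (L - 3) * R\<^sup>2 - (L + 3) * R) div 2 + 1) \<ge> R"
      by (auto dest!: half)
    have i: "int (3 * r - 1) = 3 * R - 1" using r by (simp add: R_def)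
    have "q ^ s\<^sup>2 * bailey_alpha l q s = - (q powi ((3 * R - 1)\<^sup>2 + ((3 * (L - 3) * R\<^sup>2 - (L + 3) * R) div 2 + 1)))"
      unfolding 3 bailey_alpha_eqs(4)[OF r] sq i L_def[symmetric] R_def[symmetric]
      by (simp only: power_int_add[OF disjI1[OF q(1)]]) simp
    with pw[OF e] show ?thesis
      by (simp add: order_trans[OF _ mult_right_mono[of 1 2]])
  qed
qed

section \<open>Passage to the limit and evaluation as a product\<close>

theorem mainTheorem4:
  fixes l :: nat and q :: complex
  assumes "l \<ge> 2" and "0 < norm q" and "norm q < 1"
  shows "(\<lambda>m::nat. q ^ (9 * m\<^sup>2) *
            (q powi (- 6 * int m + 1) * bailey_beta l q (3 * int m - 1)
             + bailey_beta l q (3 * int m)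
             + q powi (6 * int m + 1) * bailey_beta l q (3 * int m + 1)))
         sums
         (qpochs_inf [q ^ 2, q ^ (l + 1), q ^ (l + 3)] (q ^ (l + 3))
          * qpochs_inf [q ^ (l - 1), q ^ (l + 7)] (q ^ (2 * l + 6))
          / qpoch_inf q q)"
proof -
  have q0: "q \<noteq> 0" and q1: "norm q < 1" using assms by auto
  define t where "t = (\<lambda>m::nat. q ^ (9 * m\<^sup>2) *
            (q powi (- 6 * int m + 1) * bailey_beta l q (3 * int m - 1)
             + bailey_beta l q (3 * int m)
             + q powi (6 * int m + 1) * bailey_beta l q (3 * int m + 1)))"
  define f where "f s = q ^ s\<^sup>2 * bailey_alpha l q s" for s
  \<comment> \<open>The inner sum that arises when the left-hand side is cut off after
    \<open>M\<close> groups. It tends to the same limit for every \<open>s\<close>, and this yields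
    the common factor \<open>inverse (qpoch_inf q q)\<close>.\<close>
  define P where "P M s = (\<Sum>k<3 * M - 1 - s. durfee_summand q (2 * s) k)" for M s
  define g where "g r M = triple (\<lambda>s. f s * P M s) r" for r M
  have t: "t m = triple (\<lambda>n. q ^ n\<^sup>2 * bailey_beta l q (int n)) m" for m
  \<comment> \<open>At \<open>m = 0\<close> the value of \<open>bailey_beta\<close> at -1 is 0, in
    agreement with the convention in \<open>triple\<close>.\<close>
  proof (cases "m = 0")
    case True
    then show ?thesis by (simp add: t_def triple_def bailey_beta_def)
  next
    case False
    have ints: "3 * int m - 1 = int (3 * m - 1)" "3 * int m = int (3 * m)" "3 * int m + 1 = int (3 * m + 1)"
      using False by auto
    have sq: "q ^ n\<^sup>2 = q powi (int n)\<^sup>2" for n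
      by (metis of_nat_power power_int_of_nat)
    have e1: "q ^ (9 * m\<^sup>2) = q ^ (3 * m)\<^sup>2"
      by (simp add: power2_eq_square)
    have e2: "q ^ (3 * m)\<^sup>2 * q powi (- 6 * int m + 1) = q ^ (3 * m - 1)\<^sup>2"
      "q ^ (3 * m)\<^sup>2 * q powi (6 * int m + 1) = q ^ (3 * m + 1)\<^sup>2"
      unfolding sq power_int_add[OF disjI1[OF q0], symmetric] ints[symmetric]
      using False by (simp_all add: power2_eq_square algebra_simps)
    show ?thesis
      unfolding t_def triple_def e1 distrib_left mult.assoc[symmetric] e2 ints
      using False by (simp add: add.commute)
  qed
  have "(\<Sum>m<M. t m) = (\<Sum>r\<in>{..<M}. g r M)" for M
    unfolding t g_def sum_triple sum_power_times_bailey_beta f_def P_def by simp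
  obtain B where B: "B > 0" "\<And>c k. norm (durfee_summand q c k) \<le> B * norm q ^ k"
    by (rule durfee_summand_bound[OF q1]) blast
  define K where "K = (\<Sum>k. B * norm q ^ k)"
  have geo: "summable (\<lambda>k. B * norm q ^ k)"
    using q1 by (intro summable_mult summable_geometric) simp
  have P_bound: "norm (P M s) \<le> K" for M s
  proof -
    have "norm (P M s) \<le> (\<Sum>k<3 * M - 1 - s. B * norm q ^ k)"
      unfolding P_def by (intro sum_norm_le B)
    also have "\<dots> \<le> K"
      unfolding K_def using B(1) by (intro sum_le_suminf[OF geo]) auto
    finally show ?thesis .
  qed
  have K0: "0 \<le> K" using P_bound norm_ge_zero order_trans by blast
  have P_lim: "(\<lambda>M. P M s) \<longlonglongrightarrow> inverse (qpoch_inf q q)" for s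
  proof -
    have "filterlim (\<lambda>M. 3 * M - 1 - s) sequentially sequentially"
      by (rule filterlim_at_top_mono[OF filterlim_minus_const_nat_at_top[of "s + 1"]])
         (auto intro: always_eventually)
    then show ?thesis
      unfolding P_def
      using filterlim_compose durfee_rectangle_sums[OF q1, of "2 * s"] by (auto simp: sums_def)
  qed
  have f_bound: "norm (f s * P M s) \<le> 2 * norm q ^ r * K"
    if "s \<in> {3 * r, 3 * r + 1} \<or> (r \<ge> 1 \<and> s = 3 * r - 1)" for s r M
    unfolding f_def norm_mult[of _ "P M s"]
    by (intro mult_mono norm_power_times_bailey_alpha_le assms(1) q0 q1 that P_bound) auto
  have g_bound: "norm (g r M) \<le> 6 * K * norm q ^ r" for r M
  proof -
    have "norm (g r M) \<le> 2 * norm q ^ r * K + 2 * norm q ^ r * K + 2 * norm q ^ r * K"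
      unfolding g_def triple_def using K0
      by (intro norm_triangle_le add_mono) (auto intro!: f_bound norm_triangle_le add_mono)
    then show ?thesis by (simp add: mult_ac)
  qed
  have lim: "(\<lambda>M. g r M) \<longlonglongrightarrow> triple f r * inverse (qpoch_inf q q)" for r
    unfolding g_def triple_def distrib_right
    by (cases "r = 0") (auto intro!: tendsto_intros P_lim)
  have M: "summable (\<lambda>r. 6 * K * norm q ^ r)" "\<And>r. 0 \<le> 6 * K * norm q ^ r"
    using q1 K0 by (auto intro!: summable_mult summable_geometric)
  define Q where "Q = q ^ (l + 3)"
  have "summable (\<lambda>r. triple f r * inverse (qpoch_inf q q))"
    "(\<lambda>M. \<Sum>r\<in>{..<M}. g r M) \<longlonglongrightarrow> (\<Sum>r. triple f r * inverse (qpoch_inf q q))"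
    by (rule tannery_finite_sums[where A = "\<lambda>M. {..<M}", OF lim g_bound M]; simp add: eventually_gt_at_top)+
  then have "t sums (\<Sum>r. triple f r * inverse (qpoch_inf q q))"
    unfolding sums_def \<open>\<And>M. (\<Sum>m<M. t m) = (\<Sum>r\<in>{..<M}. g r M)\<close> by simp
  moreover have "triple f sums (qpochs_inf [Q, q\<^sup>2, Q / q\<^sup>2] Q * qpochs_inf [Q * (q\<^sup>2)\<^sup>2, Q / (q\<^sup>2)\<^sup>2] (Q\<^sup>2))"
  proof -
    \<comment> \<open>As \<open>q\<close> is nonzero of norm below 1, only exponent 0 gives the
      power 1. Then \<open>l + 3\<close> would divide 4, but \<open>l \<ge> 2\<close> makes it at
      least 5.\<close>
    have "(q\<^sup>2)\<^sup>2 * Q powi k \<noteq> 1" for k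
    proof
      assume *: "(q\<^sup>2)\<^sup>2 * Q powi k = 1"
      have "(q\<^sup>2)\<^sup>2 * Q powi k = q powi (4 + int (l + 3) * k)"
        using q0 by (simp add: Q_def power_int_add power_int_power del: of_nat_add)
      with * have "q powi (4 + int (l + 3) * k) = 1" by simp
      then have "4 + int (l + 3) * k = 0"
        using q1 by (cases "4 + int (l + 3) * k" rule: int_cases2)
          (auto simp: power_int_minus dest: power_eq_1_iff)
      then have "int (l + 3) dvd 4" by (metis add.commute add_eq_0_iff dvd_minus_iff dvd_triv_left)
      then have "int (l + 3) \<le> 4" by (rule zdvd_imp_le) simp
      with assms(1) show False by simp
    qed
    moreover have "norm Q < 1" using q1 by (simp add: Q_def norm_power power_less_one_iff)
    ultimately show ?thesis
      using quintuple_product[of Q "q\<^sup>2"] q0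
      unfolding f_def bailey_alpha_quintuple[OF q0] Q_def by simp
  qed
  then have "(\<Sum>r. triple f r * inverse (qpoch_inf q q))
      = qpochs_inf [Q, q\<^sup>2, Q / q\<^sup>2] Q * qpochs_inf [Q * (q\<^sup>2)\<^sup>2, Q / (q\<^sup>2)\<^sup>2] (Q\<^sup>2) * inverse (qpoch_inf q q)"
    using sums_mult2 sums_unique by metis
  moreover have "Q / q\<^sup>2 = q ^ (l + 1)" "Q * (q\<^sup>2)\<^sup>2 = q ^ (l + 7)" "Q\<^sup>2 = q ^ (2 * l + 6)"
    using q0 by (simp_all add: Q_def power_add power2_eq_square eval_nat_numeral mult_ac mult_2)
  moreover have "Q / (q\<^sup>2)\<^sup>2 = q ^ (l - 1)"
  proof -
    have "Q = q ^ (l - 1) * (q\<^sup>2)\<^sup>2"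
      unfolding Q_def power_mult[symmetric] power_add[symmetric] using assms(1)
      by (intro arg_cong[where f = "\<lambda>n. q ^ n"]) simp
    with q0 show ?thesis by simp
  qed
  ultimately show ?thesis
    unfolding t_def by (simp add: qpochs_inf_def Q_def divide_inverse mult_ac)
qed

end
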